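(* Let $\mathcal{K}(\mathbb{E}_2)\cong\mathbb{R}^6$ be the space of Killing $2$-tensors of the Euclidean plane with coordinates $(A,B,C,\alpha,\beta,\gamma)$, let $\Delta_E$ be the distribution spanned by $V_1,\dots,V_6$, let $G_E$ be the web-type preserving group, and let $S_1,S_2$ be the subsets defined in the context. Outside of $S_1\cup S_2$ the distribution $\Delta_E$ has rank $6$, and the set $\mathcal{K}(\mathbb{E}_2)\setminus(S_1\cup S_2)$ is an orbit of the action of $G_E$ on $\mathcal{K}(\mathbb{E}_2)$.
   Context: In the Euclidean plane $\mathbb{E}_2$ with Cartesian coordinates $(x,y)$ and standard metric $\mathbf{g}$, the general Killing $2$-tensor has contravariant components $K^{11}=A+2\alpha y+\gamma y^2$, $K^{12}=K^{21}=C-\alpha x-\beta y-\gamma xy$, $K^{22}=B+2\beta x+\gamma x^2$, with $A,B,C,\alpha,\beta,\gamma\in\mathbb{R}$. So the vector space $\mathcal{K}(\mathbb{E}_2)$ of Killing $2$-tensors is identified with $\mathbb{R}^6$ with coordinates $(A,B,C,\alpha,\beta,\gamma)$. With respect to $(\partial_A,\partial_B,\partial_C,\partial_\alpha,\partial_\beta,\partial_\gamma)$ define the following vector fields on $\mathcal{K}(\mathbb{E}_2)$, generating the transformations which preserve the type of the web: $V_1=(0,-2\beta,\alpha,0,-\gamma,0)$ and $V_2=(-2\alpha,0,\beta,-\gamma,0,0)$ (translations); $V_3=(-2C,2C,A-B,\beta,-\alpha,0)$ (rotation); $V_4=(2A,2B,2C,\alpha,\beta,0)$ (dilatation of the plane);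 $V_5=(1,1,0,0,0,0)$ (addition of a multiple of the metric, $\mathbf{K}\mapsto\mathbf{K}+\tau\mathbf{g}$); $V_6=(A,B,C,\alpha,\beta,\gamma)$ (scalar multiplication, $\mathbf{K}\mapsto\lambda\mathbf{K}$). $\Delta_E$ is the distribution spanned by $V_1,\dots,V_6$; its rank at a point is the dimension of the span of the values of $V_1,\dots,V_6$ at that point. $G_E$ is the group of transformations of $\mathcal{K}(\mathbb{E}_2)$ generated by the flows of $V_1,\dots,V_6$ together with the change of sign $\mathbf{K}\mapsto-\mathbf{K}$. $S_1=\{\gamma=0\}$; $S_2=\{\alpha^2-\beta^2=\gamma(A-B),\ \alpha\beta=-\gamma C\}$. *)

theory Defs
  imports "HOL-Analysis.Analysis" "HOL-Algebra.Group_Action" "HOL-Algebra.Generated_Groups"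
begin

(* The coordinates (A, B, C, \<alpha>, \<beta>, \<gamma>) on the space of Killing 2-tensors of the
   Euclidean plane. *)
type_synonym killing = "real \<times> real \<times> real \<times> real \<times> real \<times> real"

(* The tensor field with the given coordinates: its matrix of contravariant
   components at the point (x, y). *)
fun killing_tensor :: "killing \<Rightarrow> real \<times> real \<Rightarrow> real^2^2" where
  "killing_tensor (A, B, C, \<alpha>, \<beta>, \<gamma>) (x, y) =
     vector [vector [A + 2 * \<alpha> * y + \<gamma> * y\<^sup>2, C - \<alpha> * x - \<beta> * y - \<gamma> * x * y],
             vector [C - \<alpha> * x - \<beta> * y - \<gamma> * x * y, B + 2 * \<beta> * x + \<gamma> * x\<^sup>2]]"

(* Linearity and injectivity justify working in coordinates. *)
lemma killing_tensor_add:
  "killing_tensor (p + q) z = killing_tensor p z + killing_tensor q z"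
  by (cases p; cases q; cases z) (simp add: vec_eq_iff forall_2 algebra_simps)

lemma killing_tensor_scaleR:
  "killing_tensor (c *\<^sub>R p) z = c *\<^sub>R killing_tensor p z"
  by (cases p; cases z) (simp add: vec_eq_iff forall_2 algebra_simps)

lemma inj_killing_tensor: "inj killing_tensor"
proof (rule injI)
  fix p q assume eq: "killing_tensor p = killing_tensor q"
  obtain A B C a b c where p: "p = (A, B, C, a, b, c)" by (cases p)
  obtain A' B' C' a' b' c' where q: "q = (A', B', C', a', b', c')" by (cases q)
  have comps: "A + 2 * a * y + c * y\<^sup>2 = A' + 2 * a' * y + c' * y\<^sup>2"
    "C - a * x - b * y - c * x * y = C' - a' * x - b' * y - c' * x * y"
    "B + 2 * b * x + c * x\<^sup>2 = B' + 2 * b' * x + c' * x\<^sup>2" for x y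
    using fun_cong[OF eq, of "(x, y)"] by (simp_all add: p q vec_eq_iff forall_2)
  show "p = q"
    using comps(1)[of 0] comps(1)[of 1] comps(1)[of "- 1"] comps(2)[of 0 0] comps(2)[of 0 1]
      comps(3)[of 0] by (simp add: p q)
qed

lemma killing_tensor_metric: "killing_tensor (1, 1, 0, 0, 0, 0) z = mat 1"
  by (cases z) (simp add: vec_eq_iff forall_2 mat_def)

fun V1 :: "killing \<Rightarrow> killing" where
  "V1 (A, B, C, \<alpha>, \<beta>, \<gamma>) = (0, - 2 * \<beta>, \<alpha>, 0, - \<gamma>, 0)"

fun V2 :: "killing \<Rightarrow> killing" where
  "V2 (A, B, C, \<alpha>, \<beta>, \<gamma>) = (- 2 * \<alpha>, 0, \<beta>, - \<gamma>, 0, 0)"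

fun V3 :: "killing \<Rightarrow> killing" where
  "V3 (A, B, C, \<alpha>, \<beta>, \<gamma>) = (- 2 * C, 2 * C, A - B, \<beta>, - \<alpha>, 0)"

fun V4 :: "killing \<Rightarrow> killing" where
  "V4 (A, B, C, \<alpha>, \<beta>, \<gamma>) = (2 * A, 2 * B, 2 * C, \<alpha>, \<beta>, 0)"

fun V5 :: "killing \<Rightarrow> killing" where
  "V5 (A, B, C, \<alpha>, \<beta>, \<gamma>) = (1, 1, 0, 0, 0, 0)"

fun V6 :: "killing \<Rightarrow> killing" where
  "V6 (A, B, C, \<alpha>, \<beta>, \<gamma>) = (A, B, C, \<alpha>, \<beta>, \<gamma>)"

definition web_fields :: "(killing \<Rightarrow> killing) set" where
  "web_fields = {V1, V2, V3, V4, V5, V6}"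

definition Delta_E :: "killing \<Rightarrow> killing set" where
  "Delta_E p = span {V p | V. V \<in> web_fields}"

definition rank_at :: "('a::real_vector \<Rightarrow> 'a set) \<Rightarrow> 'a \<Rightarrow> nat" where
  "rank_at D p = dim (D p)"

(* Global flows only: the affine fields V1, ..., V6 are all complete. *)
definition is_flow :: "('a::real_normed_vector \<Rightarrow> 'a) \<Rightarrow> (real \<Rightarrow> 'a \<Rightarrow> 'a) \<Rightarrow> bool" where
  "is_flow V \<phi> \<longleftrightarrow>
     \<phi> 0 = id \<and>
     (\<forall>s t. \<phi> (s + t) = \<phi> s \<circ> \<phi> t) \<and>
     (\<forall>p t. ((\<lambda>s. \<phi> s p) has_vector_derivative V (\<phi> t p)) (at t))"

definition G_E_generators :: "(killing \<Rightarrow> killing) set" where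
  "G_E_generators =
     {\<phi> t | V \<phi> t. V \<in> web_fields \<and> is_flow V \<phi>} \<union> {\<lambda>K. - K}"

definition G_E :: "(killing \<Rightarrow> killing) monoid" where
  "G_E = (BijGroup UNIV)\<lparr>carrier := generate (BijGroup UNIV) G_E_generators\<rparr>"

lemma is_flow_bij:
  assumes "is_flow V \<phi>"
  shows "bij (\<phi> t)"
proof (rule o_bij)
  have id: "\<phi> 0 = id" and add: "\<phi> (r + s) = \<phi> r \<circ> \<phi> s" for r s
    using assms unfolding is_flow_def by auto
  show "\<phi> (- t) \<circ> \<phi> t = id" using add[of "- t" t] id by simp
  show "\<phi> t \<circ> \<phi> (- t) = id" using add[of t "- t"] id by simp
qed

lemma G_E_generators_subset: "G_E_generators \<subseteq> carrier (BijGroup UNIV)"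
proof -
  have "bij (\<lambda>K::killing. - K)"
    by (rule o_bij[where g = "\<lambda>K. - K"]) auto
  then show ?thesis
    by (auto simp: G_E_generators_def BijGroup_def Bij_def is_flow_bij)
qed

lemma G_E_action: "group_action G_E UNIV (\<lambda>g. g)"
proof -
  interpret B: group "BijGroup (UNIV :: killing set)" by (rule group_BijGroup)
  have sub: "subgroup (generate (BijGroup UNIV) G_E_generators) (BijGroup UNIV)"
    by (rule B.generate_is_subgroup[OF G_E_generators_subset])
  show ?thesis
    unfolding group_action_def group_hom_def group_hom_axioms_def G_E_def
    using B.subgroup_imp_group[OF sub] subgroup.subset[OF sub] group_BijGroup
    by (auto simp: hom_def)
qed

definition S1 :: "killing set" where
  "S1 = {(A, B, C, \<alpha>, \<beta>, \<gamma>). \<gamma> = 0}"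

definition S2 :: "killing set" where
  "S2 = {(A, B, C, \<alpha>, \<beta>, \<gamma>). \<alpha>\<^sup>2 - \<beta>\<^sup>2 = \<gamma> * (A - B) \<and> \<alpha> * \<beta> = - \<gamma> * C}"

end

theory Submission
  imports Defs
begin

text \<open>
  Everything is governed by one polynomial of degree five, \<open>D = \<gamma> * (f\<^sup>2 + 4 * g\<^sup>2)\<close> with
  \<open>f = \<alpha>\<^sup>2 - \<beta>\<^sup>2 - \<gamma> * (A - B)\<close> and \<open>g = \<alpha> * \<beta> + \<gamma> * C\<close> (\<open>frame_det\<close>),
  whose real zero set is exactly the union of \<open>S1\<close> and \<open>S2\<close>. Up to a constant factor, \<open>D\<close> is
  the determinant of the six generators \<open>V1 p, \<dots>, V6 p\<close>, so they are linearly independent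
  wherever \<open>D p \<noteq> 0\<close> (\<open>rank_Delta_E\<close>).

  The derivative of \<open>D\<close> along each generator is a constant multiple of \<open>D\<close>
  (\<open>frame_det_semi_invariant\<close>). Hence along every integral curve \<open>D\<close> is multiplied by an
  exponential, and the group cannot leave or enter the zero set (\<open>G_E_preserves_zeros\<close>): the
  complement of the zero set is a union of orbits.

  It is a single orbit because every tensor with \<open>D \<noteq> 0\<close> can be brought to the same normal form
  \<open>(1, 0, 0, 0, 0, 1)\<close> (\<open>normal_form\<close>). Geometrically, \<open>K\<close> is a multiple of the metric at \<open>z = x + i y\<close>
  iff \<open>K11 = K22\<close> and \<open>K12 = 0\<close>. For \<open>\<gamma> \<noteq> 0\<close> this is one quadratic equation for \<open>z\<close>, whose two
  roots are the foci of the web; they coincide iff \<open>f = g = 0\<close>. So \<open>D \<noteq> 0\<close> characterises the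
  elliptic-hyperbolic webs. Translations move the midpoint of the foci to the origin, a scaling
  (preceded by a change of sign if \<open>\<gamma> < 0\<close>) gives \<open>\<gamma> = 1\<close>, a rotation puts the foci on the
  \<open>x\<close>-axis, and adding a multiple of the metric and dilating make the remaining entries \<open>1\<close> and \<open>0\<close>.
\<close>

section \<open>The determinant of the generators\<close>

fun frame_det :: "killing \<Rightarrow> real" where
  "frame_det (A, B, C, \<alpha>, \<beta>, \<gamma>) =
     \<gamma> * ((\<alpha>\<^sup>2 - \<beta>\<^sup>2 - \<gamma> * (A - B))\<^sup>2 + 4 * (\<alpha> * \<beta> + \<gamma> * C)\<^sup>2)"

lemma frame_det_zero_iff: "frame_det p = 0 \<longleftrightarrow> p \<in> S1 \<union> S2"
proof -
  obtain A B C \<alpha> \<beta> \<gamma> where p: "p = (A, B, C, \<alpha>, \<beta>, \<gamma>)" by (cases p)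
  show ?thesis
    by (auto simp: p S1_def S2_def add_nonneg_eq_0_iff)
qed

lemma frame_det_uminus: "frame_det (- p) = - frame_det p"
  by (cases p) (simp add: power2_eq_square algebra_simps)

section \<open>Linear independence of the generators\<close>

fun combination :: "killing \<Rightarrow> killing \<Rightarrow> killing" where
  "combination p (c1, c2, c3, c4, c5, c6) =
     c1 *\<^sub>R V1 p + c2 *\<^sub>R V2 p + c3 *\<^sub>R V3 p + c4 *\<^sub>R V4 p + c5 *\<^sub>R V5 p + c6 *\<^sub>R V6 p"

lemma linear_combination: "linear (combination p)"
  by (rule linearI; cases p) (auto simp: algebra_simps)

lemma combination_in_Delta_E: "combination p c \<in> Delta_E p"
proof -
  obtain c1 c2 c3 c4 c5 c6 where c: "c = (c1, c2, c3, c4, c5, c6)" by (cases c)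
  have "V p \<in> span {V p | V. V \<in> web_fields}" if "V \<in> web_fields" for V
    using that by (auto intro: span_base)
  then show ?thesis
    unfolding c Delta_E_def combination.simps
    by (intro span_add span_scale) (simp_all add: web_fields_def)
qed

text \<open>
  Gaussian elimination: the last three coordinates of a vanishing combination eliminate \<open>c6\<close>, \<open>c1\<close> and
  \<open>c2\<close>, and the difference of the first two drops \<open>c5\<close>; what remains is a system for \<open>c3\<close> and \<open>c4\<close> with matrix rows \<open>(2 g, f)\<close> and \<open>(- f, 2 g)\<close>,
  a complex multiplication by a nonzero number.
\<close>

lemma combination_eq_0_imp:
  assumes "frame_det p \<noteq> 0" and "combination p c = 0"
  shows "c = 0"
proof -
  obtain A B C \<alpha> \<beta> \<gamma> where p: "p = (A, B, C, \<alpha>, \<beta>, \<gamma>)" by (cases p)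
  obtain c1 c2 c3 c4 c5 c6 where c: "c = (c1, c2, c3, c4, c5, c6)" by (cases c)
  define f where "f = \<alpha>\<^sup>2 - \<beta>\<^sup>2 - \<gamma> * (A - B)"
  define g where "g = \<alpha> * \<beta> + \<gamma> * C"
  have \<gamma>: "\<gamma> \<noteq> 0" and fg: "f\<^sup>2 + 4 * g\<^sup>2 \<noteq> 0"
    using assms(1) by (simp_all add: p f_def g_def)
  have 6: "c6 = 0"
    using assms(2) \<gamma> by (simp add: p c zero_prod_def)
  have eqs: "- 2 * \<alpha> * c2 - 2 * C * c3 + 2 * A * c4 + c5 = 0"
    "- 2 * \<beta> * c1 + 2 * C * c3 + 2 * B * c4 + c5 = 0"
    "\<alpha> * c1 + \<beta> * c2 + (A - B) * c3 + 2 * C * c4 = 0"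
    "\<gamma> * c2 = \<beta> * c3 + \<alpha> * c4"
    "\<gamma> * c1 = \<beta> * c4 - \<alpha> * c3"
    using assms(2) by (simp_all add: p c 6 zero_prod_def algebra_simps)
  have "2 * g * c3 + f * c4 = 0" "2 * g * c4 - f * c3 = 0"
    using eqs unfolding f_def g_def by algebra+
  then have "(f\<^sup>2 + 4 * g\<^sup>2) * c3 = 0" "(f\<^sup>2 + 4 * g\<^sup>2) * c4 = 0"
    by algebra+
  then have 34: "c3 = 0" "c4 = 0"
    using fg by simp_all
  then have "c1 = 0" "c2 = 0" "c5 = 0"
    using eqs \<gamma> by simp_all
  then show ?thesis
    by (simp add: c 6 34 zero_prod_def)
qed

lemma rank_Delta_E:
  assumes "frame_det p \<noteq> 0"
  shows "rank_at Delta_E p = 6"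
proof -
  have "inj (combination p)"
    using combination_eq_0_imp[OF assms] linear_combination
    by (auto simp: linear_injective_0)
  then have "surj (combination p)"
    by (rule linear_inj_imp_surj[OF linear_combination])
  then have "Delta_E p = UNIV"
    using combination_in_Delta_E by (metis UNIV_eq_I surjD)
  then show ?thesis
    by (simp add: rank_at_def)
qed

section \<open>Invariance of the exceptional set\<close>

lemma exponential_ode_solution:
  fixes h :: "real \<Rightarrow> real"
  assumes "\<And>t. (h has_real_derivative k * h t) (at t)"
  shows "h t = exp (k * t) * h 0"
proof -
  have "((\<lambda>t. exp (- k * t) * h t) has_real_derivative 0) (at t)" for t
    by (rule derivative_eq_intros assms refl | simp)+
  then have "exp (- k * t) * h t = exp (- k * 0) * h 0"
    by (intro DERIV_isconst_all) blast
  then show ?thesis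
    by (simp add: exp_minus field_simps)
qed

text \<open>
  The second argument is the velocity. The differential is kept as an explicit polynomial so that its
  values on the generators reduce to ring identities.
\<close>

fun frame_det_differential :: "killing \<Rightarrow> killing \<Rightarrow> real" where
  "frame_det_differential (A, B, C, \<alpha>, \<beta>, \<gamma>) (A', B', C', \<alpha>', \<beta>', \<gamma>') =
     (let f = \<alpha>\<^sup>2 - \<beta>\<^sup>2 - \<gamma> * (A - B); g = \<alpha> * \<beta> + \<gamma> * C in
      \<gamma>' * (f\<^sup>2 + 4 * g\<^sup>2) +
      \<gamma> * (2 * f * (2 * \<alpha> * \<alpha>' - 2 * \<beta> * \<beta>' - \<gamma>' * (A - B) - \<gamma> * (A' - B')) +
           8 * g * (\<alpha>' * \<beta> + \<alpha> * \<beta>' + \<gamma>' * C + \<gamma> * C')))"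

lemma has_vector_derivative_Pair_iff:
  "((\<lambda>s. (f s, g s)) has_vector_derivative (f', g')) (at t) \<longleftrightarrow>
     (f has_vector_derivative f') (at t) \<and> (g has_vector_derivative g') (at t)"
proof safe
  assume fg: "((\<lambda>s. (f s, g s)) has_vector_derivative (f', g')) (at t)"
  show "(f has_vector_derivative f') (at t)"
    using bounded_linear.has_vector_derivative[OF bounded_linear_fst fg] by simp
  show "(g has_vector_derivative g') (at t)"
    using bounded_linear.has_vector_derivative[OF bounded_linear_snd fg] by simp
next
  assume "(f has_vector_derivative f') (at t)" "(g has_vector_derivative g') (at t)"
  then show "((\<lambda>s. (f s, g s)) has_vector_derivative (f', g')) (at t)"
    unfolding has_vector_derivative_def scaleR_Pair by (rule has_derivative_Pair)
qed

lemma frame_det_chain_rule: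
  assumes u: "(u has_vector_derivative v) (at t)"
  shows "((\<lambda>s. frame_det (u s)) has_real_derivative frame_det_differential (u t) v) (at t)"
proof -
  define A where "A s = fst (u s)" for s
  define B where "B s = fst (snd (u s))" for s
  define C where "C s = fst (snd (snd (u s)))" for s
  define \<alpha> where "\<alpha> s = fst (snd (snd (snd (u s))))" for s
  define \<beta> where "\<beta> s = fst (snd (snd (snd (snd (u s)))))" for s
  define \<gamma> where "\<gamma> s = snd (snd (snd (snd (snd (u s)))))" for s
  obtain A' B' C' \<alpha>' \<beta>' \<gamma>' where v: "v = (A', B', C', \<alpha>', \<beta>', \<gamma>')" by (cases v)
  have u_eq: "u = (\<lambda>s. (A s, B s, C s, \<alpha> s, \<beta> s, \<gamma> s))"
    by (simp add: A_def B_def C_def \<alpha>_def \<beta>_def \<gamma>_def)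
  have "(A has_real_derivative A') (at t)" "(B has_real_derivative B') (at t)"
    "(C has_real_derivative C') (at t)" "(\<alpha> has_real_derivative \<alpha>') (at t)"
    "(\<beta> has_real_derivative \<beta>') (at t)" "(\<gamma> has_real_derivative \<gamma>') (at t)"
    using u unfolding u_eq v has_vector_derivative_Pair_iff
      has_real_derivative_iff_has_vector_derivative by simp_all
  then show ?thesis
    unfolding u_eq v frame_det.simps frame_det_differential.simps Let_def
    by (auto intro!: derivative_eq_intros simp: power2_eq_square algebra_simps)
qed

text \<open>
  For \<open>\<gamma> \<noteq> 0\<close> the polynomial is \<open>\<gamma> ^ 5 * d ^ 4\<close>, where \<open>d\<close> is half the distance between the foci. Isometries
  and metric shifts preserve both \<open>\<gamma>\<close> and \<open>d\<close>, which gives the multiplier 0; dilatations stretch \<open>d\<close> at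
  unit rate, which gives 4; scalar multiplication stretches \<open>\<gamma>\<close> at unit rate and keeps the foci, which
  gives 5.
\<close>

lemma frame_det_semi_invariant:
  assumes "V \<in> web_fields"
  obtains k where "\<And>p. frame_det_differential p (V p) = k * frame_det p"
proof -
  have "frame_det_differential p (V1 p) = 0 * frame_det p" for p
    by (cases p) (simp add: Let_def power2_eq_square algebra_simps)
  moreover have "frame_det_differential p (V2 p) = 0 * frame_det p" for p
    by (cases p) (simp add: Let_def power2_eq_square algebra_simps)
  moreover have "frame_det_differential p (V3 p) = 0 * frame_det p" for p
    by (cases p) (simp add: Let_def power2_eq_square algebra_simps)
  moreover have "frame_det_differential p (V4 p) = 4 * frame_det p" for p
    by (cases p) (simp add: Let_def power2_eq_square algebra_simps)
  moreover have "frame_det_differential p (V5 p) = 0 * frame_det p" for p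
    by (cases p) (simp add: Let_def power2_eq_square algebra_simps)
  moreover have "frame_det_differential p (V6 p) = 5 * frame_det p" for p
    by (cases p) (simp add: Let_def power2_eq_square algebra_simps)
  ultimately show thesis
    using assms that unfolding web_fields_def by blast
qed

text \<open>
  The equation for \<open>D\<close> along an integral curve is enough here: it applies to any flow of \<open>V\<close>,
  whether or not that flow is known in closed form.
\<close>

lemma flow_preserves_zeros:
  assumes "V \<in> web_fields" and "is_flow V \<phi>"
  shows "frame_det (\<phi> t p) = 0 \<longleftrightarrow> frame_det p = 0"
proof -
  obtain k where k: "\<And>q. frame_det_differential q (V q) = k * frame_det q"
    using frame_det_semi_invariant[OF assms(1)] by metis
  have "((\<lambda>s. frame_det (\<phi> s p)) has_real_derivative k * frame_det (\<phi> s p)) (at s)" for s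
    using frame_det_chain_rule[of "\<lambda>s. \<phi> s p"] assms(2) by (metis k is_flow_def)
  then have "frame_det (\<phi> t p) = exp (k * t) * frame_det (\<phi> 0 p)"
    by (rule exponential_ode_solution)
  then show ?thesis
    using assms(2) by (simp add: is_flow_def)
qed

lemma G_E_preserves_zeros:
  assumes "g \<in> carrier G_E"
  shows "frame_det (g p) = 0 \<longleftrightarrow> frame_det p = 0"
proof -
  interpret B: group "BijGroup (UNIV :: killing set)" by (rule group_BijGroup)
  have gen: "frame_det (h q) = 0 \<longleftrightarrow> frame_det q = 0" if "h \<in> G_E_generators" for h q
  proof -
    from that consider V \<phi> t where "h = \<phi> t" "V \<in> web_fields" "is_flow V \<phi>" | "h = (\<lambda>K. - K)"
      unfolding G_E_generators_def by blast
    then show ?thesis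
    proof cases
      case 1
      then show ?thesis using flow_preserves_zeros[OF 1(2,3)] by blast
    next
      case 2
      then show ?thesis unfolding 2 frame_det_uminus by linarith
    qed
  qed
  have "g \<in> generate (BijGroup UNIV) G_E_generators"
    using assms by (simp add: G_E_def)
  then show ?thesis
  proof (induction arbitrary: p)
    case one
    then show ?case by (simp add: BijGroup_def)
  next
    case (incl h)
    then show ?case by (rule gen)
  next
    case (inv h)
    have h: "h \<in> Bij UNIV"
      using inv G_E_generators_subset by (auto simp: BijGroup_def)
    then have "h (inv_into UNIV h p) = p"
      by (simp add: Bij_def bij_is_surj surj_f_inv_f)
    then show ?case
      using gen[OF inv, of "inv_into UNIV h p"] by (simp add: inv_BijGroup[OF h])
  next
    case (eng h1 h2)
    have "h1 \<in> Bij UNIV" "h2 \<in> Bij UNIV"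
      using eng.hyps[THEN B.generate_in_carrier[OF G_E_generators_subset]]
      by (simp_all add: BijGroup_def)
    then have "(h1 \<otimes>\<^bsub>BijGroup UNIV\<^esub> h2) p = h1 (h2 p)"
      by (simp add: BijGroup_def compose_def)
    then show ?case
      using eng.IH by metis
  qed
qed

section \<open>Explicit flows\<close>

text \<open>
  The translations by \<open>t\<close> substitute \<open>x - t\<close> for \<open>x\<close>, respectively \<open>y - t\<close> for \<open>y\<close>, in the components of
  the tensor. Under a rotation \<open>(A - B, 2 C)\<close> turns at twice the speed of \<open>(\<alpha>, \<beta>)\<close>, while the trace
  \<open>A + B\<close> stays fixed.
\<close>

fun translation_x :: "real \<Rightarrow> killing \<Rightarrow> killing" where
  "translation_x t (A, B, C, \<alpha>, \<beta>, \<gamma>) =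
     (A, B - 2 * \<beta> * t + \<gamma> * t\<^sup>2, C + \<alpha> * t, \<alpha>, \<beta> - \<gamma> * t, \<gamma>)"

fun translation_y :: "real \<Rightarrow> killing \<Rightarrow> killing" where
  "translation_y t (A, B, C, \<alpha>, \<beta>, \<gamma>) =
     (A - 2 * \<alpha> * t + \<gamma> * t\<^sup>2, B, C + \<beta> * t, \<alpha> - \<gamma> * t, \<beta>, \<gamma>)"

fun rotation :: "real \<Rightarrow> killing \<Rightarrow> killing" where
  "rotation t (A, B, C, \<alpha>, \<beta>, \<gamma>) =
     ((A + B) / 2 + ((A - B) / 2 * cos (2 * t) - C * sin (2 * t)),
      (A + B) / 2 - ((A - B) / 2 * cos (2 * t) - C * sin (2 * t)),
      C * cos (2 * t) + (A - B) / 2 * sin (2 * t),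
      \<alpha> * cos t + \<beta> * sin t, \<beta> * cos t - \<alpha> * sin t, \<gamma>)"

fun dilatation :: "real \<Rightarrow> killing \<Rightarrow> killing" where
  "dilatation t (A, B, C, \<alpha>, \<beta>, \<gamma>) =
     (exp (2 * t) * A, exp (2 * t) * B, exp (2 * t) * C, exp t * \<alpha>, exp t * \<beta>, \<gamma>)"

fun metric_shift :: "real \<Rightarrow> killing \<Rightarrow> killing" where
  "metric_shift t (A, B, C, \<alpha>, \<beta>, \<gamma>) = (A + t, B + t, C, \<alpha>, \<beta>, \<gamma>)"

fun scaling :: "real \<Rightarrow> killing \<Rightarrow> killing" where
  "scaling t (A, B, C, \<alpha>, \<beta>, \<gamma>) =
     (exp t * A, exp t * B, exp t * C, exp t * \<alpha>, exp t * \<beta>, exp t * \<gamma>)"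

lemmas flow_derivative =
  has_vector_derivative_Pair_iff has_real_derivative_iff_has_vector_derivative[symmetric]

lemma is_flowI:
  assumes "\<And>p. \<phi> 0 p = p"
    and "\<And>s t p. \<phi> (s + t) p = \<phi> s (\<phi> t p)"
    and "\<And>p t. ((\<lambda>s. \<phi> s p) has_vector_derivative V (\<phi> t p)) (at t)"
  shows "is_flow V \<phi>"
  using assms by (auto simp: is_flow_def fun_eq_iff)

lemma translation_x_flow: "is_flow V1 translation_x"
proof (rule is_flowI)
  fix p :: killing and s t
  show "translation_x 0 p = p" by (cases p) simp
  show "translation_x (s + t) p = translation_x s (translation_x t p)"
    by (cases p) (simp add: power2_eq_square algebra_simps)
  show "((\<lambda>s. translation_x s p) has_vector_derivative V1 (translation_x t p)) (at t)"
    by (cases p) (auto simp: flow_derivative intro!: derivative_eq_intros)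
qed

lemma translation_y_flow: "is_flow V2 translation_y"
proof (rule is_flowI)
  fix p :: killing and s t
  show "translation_y 0 p = p" by (cases p) simp
  show "translation_y (s + t) p = translation_y s (translation_y t p)"
    by (cases p) (simp add: power2_eq_square algebra_simps)
  show "((\<lambda>s. translation_y s p) has_vector_derivative V2 (translation_y t p)) (at t)"
    by (cases p) (auto simp: flow_derivative intro!: derivative_eq_intros)
qed

lemma rotation_flow: "is_flow V3 rotation"
proof (rule is_flowI)
  fix p :: killing and s t
  show "rotation 0 p = p" by (cases p) (simp add: field_simps)
  show "rotation (s + t) p = rotation s (rotation t p)"
    by (cases p) (simp add: distrib_left cos_add sin_add field_simps)
  show "((\<lambda>s. rotation s p) has_vector_derivative V3 (rotation t p)) (at t)"
    by (cases p) (auto simp: flow_derivative field_simps intro!: derivative_eq_intros)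
qed

lemma dilatation_flow: "is_flow V4 dilatation"
proof (rule is_flowI)
  fix p :: killing and s t
  show "dilatation 0 p = p" by (cases p) simp
  show "dilatation (s + t) p = dilatation s (dilatation t p)"
    by (cases p) (simp add: distrib_left exp_add)
  show "((\<lambda>s. dilatation s p) has_vector_derivative V4 (dilatation t p)) (at t)"
    by (cases p) (auto simp: flow_derivative intro!: derivative_eq_intros)
qed

lemma metric_shift_flow: "is_flow V5 metric_shift"
proof (rule is_flowI)
  fix p :: killing and s t
  show "metric_shift 0 p = p" by (cases p) simp
  show "metric_shift (s + t) p = metric_shift s (metric_shift t p)" by (cases p) simp
  show "((\<lambda>s. metric_shift s p) has_vector_derivative V5 (metric_shift t p)) (at t)"
    by (cases p) (auto simp: flow_derivative intro!: derivative_eq_intros)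
qed

lemma scaling_flow: "is_flow V6 scaling"
proof (rule is_flowI)
  fix p :: killing and s t
  show "scaling 0 p = p" by (cases p) simp
  show "scaling (s + t) p = scaling s (scaling t p)" by (cases p) (simp add: exp_add)
  show "((\<lambda>s. scaling s p) has_vector_derivative V6 (scaling t p)) (at t)"
    by (cases p) (auto simp: flow_derivative intro!: derivative_eq_intros)
qed

section \<open>Reduction to a normal form\<close>

definition same_orbit :: "killing \<Rightarrow> killing \<Rightarrow> bool" (infix "\<sim>" 50) where
  "p \<sim> q \<longleftrightarrow> q \<in> orbit G_E (\<lambda>g. g) p"

interpretation G_E: group_action G_E UNIV "\<lambda>g. g"
  by (rule G_E_action)

lemma same_orbit_sym: "p \<sim> q \<Longrightarrow> q \<sim> p"
  unfolding same_orbit_def by (rule G_E.orbit_sym) simp_all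

lemma same_orbit_trans [trans]: "p \<sim> q \<Longrightarrow> q \<sim> r \<Longrightarrow> p \<sim> r"
  unfolding same_orbit_def by (rule G_E.orbit_trans) simp_all

lemma same_orbit_generator: "g \<in> G_E_generators \<Longrightarrow> p \<sim> g p"
  by (auto simp: same_orbit_def orbit_def G_E_def intro: generate.incl)

lemma same_orbit_flow: "V \<in> web_fields \<Longrightarrow> is_flow V \<phi> \<Longrightarrow> p \<sim> \<phi> t p"
  by (rule same_orbit_generator) (auto simp: G_E_generators_def)

lemma same_orbit_uminus: "p \<sim> - p"
  using same_orbit_generator[of "\<lambda>K. - K" p] by (simp add: G_E_generators_def)

lemma same_orbit_moves:
  "p \<sim> translation_x t p" "p \<sim> translation_y t p" "p \<sim> rotation t p"
  "p \<sim> dilatation t p" "p \<sim> metric_shift t p" "p \<sim> scaling t p"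
  by (rule same_orbit_flow[OF _ translation_x_flow] same_orbit_flow[OF _ translation_y_flow]
      same_orbit_flow[OF _ rotation_flow] same_orbit_flow[OF _ dilatation_flow]
      same_orbit_flow[OF _ metric_shift_flow] same_orbit_flow[OF _ scaling_flow],
      simp add: web_fields_def)+

lemma frame_det_same_orbit: "p \<sim> q \<Longrightarrow> frame_det q = 0 \<longleftrightarrow> frame_det p = 0"
  unfolding same_orbit_def orbit_def using G_E_preserves_zeros by blast

text \<open>
  The lemmas below normalise the web step by step. For \<open>\<alpha> = \<beta> = 0\<close> and \<open>\<gamma> \<noteq> 0\<close> the foci are the
  square roots of \<open>(A - B + 2 i C) / \<gamma>\<close>, and their midpoint is the origin. In general the midpoint is
  \<open>(- \<beta> / \<gamma>, - \<alpha> / \<gamma>)\<close>, which explains the two translations.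
\<close>

lemma centre_to_origin:
  assumes "\<gamma> \<noteq> 0"
  obtains A' B' C' where "(A, B, C, \<alpha>, \<beta>, \<gamma>) \<sim> (A', B', C', 0, 0, \<gamma>)"
proof -
  have "(A, B, C, \<alpha>, \<beta>, \<gamma>) \<sim> translation_y (\<alpha> / \<gamma>) (translation_x (\<beta> / \<gamma>) (A, B, C, \<alpha>, \<beta>, \<gamma>))"
    by (rule same_orbit_trans[OF same_orbit_moves(1) same_orbit_moves(2)])
  then show thesis
    using that assms by simp
qed

text \<open>
  The flow of scalar multiplication only has positive factors \<open>exp t\<close>; this is where the change of sign
  enters.
\<close>

lemma normalize_gamma:
  assumes "\<gamma> \<noteq> 0"
  obtains A' B' C' where "(A, B, C, 0, 0, \<gamma>) \<sim> (A', B', C', 0, 0, 1)"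
proof -
  have pos: "(a, b, c, 0, 0, r) \<sim> (a / r, b / r, c / r, 0, 0, 1)" if "r > 0" for a b c r
    using same_orbit_moves(6)[of "(a, b, c, 0, 0, r)" "- ln r"] that
    by (simp add: exp_minus field_simps)
  show thesis
  proof (cases "\<gamma> > 0")
    case True
    then show thesis using pos that by blast
  next
    case False
    have "(A, B, C, 0, 0, \<gamma>) \<sim> (- A, - B, - C, 0, 0, - \<gamma>)"
      using same_orbit_uminus[of "(A, B, C, 0, 0, \<gamma>)"] by simp
    also have "\<dots> \<sim> (- A / - \<gamma>, - B / - \<gamma>, - C / - \<gamma>, 0, 0, 1)"
      using False assms by (intro pos) simp
    finally show thesis by (rule that)
  qed
qed

text \<open>
  The complex number \<open>(A - B) / 2 + i C\<close> turns by \<open>2 t\<close> under the rotation with parameter \<open>t\<close>, so half its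
  argument makes it real and positive. Its modulus is positive by hypothesis, and the strict inequality
  \<open>a > b\<close> is what makes the dilatation in the next step possible.
\<close>

lemma diagonalize:
  assumes "(A - B)\<^sup>2 + 4 * C\<^sup>2 \<noteq> 0"
  obtains a b where "(A, B, C, 0, 0, \<gamma>) \<sim> (a, b, 0, 0, 0, \<gamma>)" and "a > b"
proof -
  define z where "z = Complex ((A - B) / 2) C"
  define r where "r = cmod z"
  define \<theta> where "\<theta> = Arg z"
  have "z \<noteq> 0"
    using assms by (auto simp: z_def complex_eq_iff)
  then have r: "r > 0"
    by (simp add: r_def)
  have "z = rcis r \<theta>"
    by (simp add: r_def \<theta>_def rcis_cmod_Arg)
  then have polar: "(A - B) / 2 = r * cos \<theta>" "C = r * sin \<theta>"
    by (simp_all add: z_def complex_eq_iff)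
  have "r * (cos \<theta> * cos \<theta>) + r * (sin \<theta> * sin \<theta>) = r"
    using sin_cos_squared_add3[of \<theta>] by (metis distrib_left mult.right_neutral)
  then have "rotation (- \<theta> / 2) (A, B, C, 0, 0, \<gamma>) = ((A + B) / 2 + r, (A + B) / 2 - r, 0, 0, 0, \<gamma>)"
    by (simp add: polar algebra_simps power2_eq_square)
  with same_orbit_moves(3)[of "(A, B, C, 0, 0, \<gamma>)" "- \<theta> / 2"]
  have "(A, B, C, 0, 0, \<gamma>) \<sim> ((A + B) / 2 + r, (A + B) / 2 - r, 0, 0, 0, \<gamma>)"
    by (simp only:)
  then show thesis
    by (rule that) (use r in simp)
qed

lemma unit_foci:
  assumes "a > b"
  shows "(a, b, 0, 0, 0, \<gamma>) \<sim> (1, 0, 0, 0, 0, \<gamma>)"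
proof -
  have "(a, b, 0, 0, 0, \<gamma>) \<sim> (a - b, 0, 0, 0, 0, \<gamma>)"
    using same_orbit_moves(5)[of "(a, b, 0, 0, 0, \<gamma>)" "- b"] by simp
  also have "\<dots> \<sim> (1, 0, 0, 0, 0, \<gamma>)"
    using same_orbit_moves(4)[of "(a - b, 0, 0, 0, 0, \<gamma>)" "- ln (a - b) / 2"] assms
    by (simp add: exp_minus)
  finally show ?thesis .
qed

lemma normal_form:
  assumes "frame_det p \<noteq> 0"
  shows "p \<sim> (1, 0, 0, 0, 0, 1)"
proof -
  obtain A B C \<alpha> \<beta> \<gamma> where p: "p = (A, B, C, \<alpha>, \<beta>, \<gamma>)" by (cases p)
  have \<gamma>: "\<gamma> \<noteq> 0"
    using assms by (auto simp: p)
  obtain A' B' C' where 1: "p \<sim> (A', B', C', 0, 0, \<gamma>)"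
    using centre_to_origin[OF \<gamma>] unfolding p .
  obtain A'' B'' C'' where 2: "(A', B', C', 0, 0, \<gamma>) \<sim> (A'', B'', C'', 0, 0, 1)"
    using normalize_gamma[OF \<gamma>] .
  note p_12 = same_orbit_trans[OF 1 2]
  \<comment> \<open>The determinant at the current tensor is \<open>(A'' - B'')\<^sup>2 + 4 * C''\<^sup>2\<close>, and it is still nonzero.\<close>
  then have "(A'' - B'')\<^sup>2 + 4 * C''\<^sup>2 \<noteq> 0"
    using frame_det_same_orbit[OF p_12] assms by (simp add: power2_commute)
  then obtain a b where 3: "(A'', B'', C'', 0, 0, 1) \<sim> (a, b, 0, 0, 0, 1)" and "a > b"
    by (rule diagonalize)
  from p_12 3 have "p \<sim> (a, b, 0, 0, 0, 1)"
    by (rule same_orbit_trans)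
  also have "\<dots> \<sim> (1, 0, 0, 0, 0, 1)"
    using \<open>a > b\<close> by (rule unit_foci)
  finally show ?thesis .
qed

theorem proposition6:
  shows "(\<forall>p. p \<notin> S1 \<union> S2 \<longrightarrow> rank_at Delta_E p = 6) \<and>
    UNIV - (S1 \<union> S2) \<in> orbits G_E UNIV (\<lambda>g. g)"
proof
  show "\<forall>p. p \<notin> S1 \<union> S2 \<longrightarrow> rank_at Delta_E p = 6"
    using rank_Delta_E by (simp add: frame_det_zero_iff)
next
  let ?e = "(1, 0, 0, 0, 0, 1) :: killing"
  have "UNIV - (S1 \<union> S2) = {p. frame_det p \<noteq> 0}"
    by (auto simp: frame_det_zero_iff)
  also have "\<dots> = {p. ?e \<sim> p}"
  proof (intro Collect_cong iffI)
    fix p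
    show "?e \<sim> p" if "frame_det p \<noteq> 0"
      using normal_form[OF that] by (rule same_orbit_sym)
    show "frame_det p \<noteq> 0" if "?e \<sim> p"
      using frame_det_same_orbit[OF that] by simp
  qed
  also have "\<dots> = orbit G_E (\<lambda>g. g) ?e"
    by (simp add: same_orbit_def)
  finally show "UNIV - (S1 \<union> S2) \<in> orbits G_E UNIV (\<lambda>g. g)"
    unfolding orbits_def by blast
qed

end
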